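(* Let $G$ be a finite simple graph with no triangles and no 4-cycles, with $n\ge3$ vertices and $m$ edges. For each $i$ let $n_i$ be the number of vertices of 2-distance degree $i$, and let $d$ and $D$ be the minimum and maximum 2-distance degree. Assume $d\ne0$, $D\ne d$, and $D\ge2$. Let $\alpha\in\mathbb{R}$, $\alpha\notin\{0,1\}$, $S_\alpha=\frac{D^\alpha-d^\alpha}{D-d}$, and let $M_1=M_1(G)=\sum_{u}d(u)^2$ be the first Zagreb index. Then: (1) $LM_1^\alpha(G)=nd^\alpha+(M_1-2m-nd)S_\alpha+\sum_{i=1}^{D-d-1}n_{d+i}\big[(d+i)^\alpha-d^\alpha-iS_\alpha\big]$. (2) $LM_1^\alpha(G)=nd^\alpha+(M_1-2m-nd)((d+1)^\alpha-d^\alpha)+\sum_{i=2}^{D-d}n_{d+i}\big[(d+i)^\alpha-d^\alpha-i((d+1)^\alpha-d^\alpha)\big]$. (3) $LM_1^-(G)=(M_1-2m)(n-1-D-d)+ndD-\sum_{i=1}^{D-d-1}n_{d+i}\,i(d+i-D)$. (4) $LM_1^-(G)=(M_1-2m)(n-2d-2)+nd(d+1)-\sum_{i=2}^{D-d}n_{d+i}\,i(i-1)$.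
   Context: For a vertex $u$ of $G$, $d(u)$ is its degree and its 2-distance degree $d_2(u)$ is the number of vertices at distance exactly 2 from $u$. The general first leap Zagreb index is $LM_1^\alpha(G)=\sum_{u\in V(G)}d_2(u)^\alpha$. Let $E_2$ be the set of unordered pairs $\{u,v\}$ of vertices at distance exactly 2 in $G$. The first leap Zagreb coindex is $LM_1^-(G)=\sum(d_2(u)+d_2(v))$, the sum over all unordered pairs $\{u,v\}$ of distinct vertices with $\{u,v\}\notin E_2$. *)

theory Defs
  imports Complex_Main "Graph_Theory.Graph_Theory"
begin

text \<open>
  A finite simple graph is a symmetric, loop-free \<^locale>\<open>pair_graph\<close>: an undirected edge
  \<open>{u, v}\<close> is represented by the two arcs \<open>(u, v)\<close> and \<open>(v, u)\<close>.
\<close>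

definition edges :: "'a pair_pre_digraph \<Rightarrow> 'a set set" where
  "edges G = {{u, v} | u v. (u, v) \<in> parcs G}"

text \<open>Each edge at \<open>u\<close> contributes exactly one arc leaving \<open>u\<close>.\<close>

definition degree :: "'a pair_pre_digraph \<Rightarrow> 'a \<Rightarrow> nat" where
  "degree G u = out_degree (with_proj G) u"

text \<open>
  In the library a path \<open>u, v, u\<close> counts as a cycle of length 2, but for lengths \<open>k \<ge> 3\<close> the
  cycles are closed walks through \<open>k\<close> distinct vertices, as in undirected graphs. The cycle need not
  be induced.
\<close>

definition has_cycle_of_length :: "'a pair_pre_digraph \<Rightarrow> nat \<Rightarrow> bool" where
  "has_cycle_of_length G k \<longleftrightarrow> (\<exists>p. pre_digraph.cycle (with_proj G) p \<and> length p = k)"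

text \<open>Shortest-path distance with unit arc weights; it is \<open>\<infinity>\<close> between different components.\<close>

definition distance :: "'a pair_pre_digraph \<Rightarrow> 'a \<Rightarrow> 'a \<Rightarrow> ereal" where
  "distance G u v = wf_digraph.\<mu> (with_proj G) (\<lambda>_. 1) u v"

definition degree2 :: "'a pair_pre_digraph \<Rightarrow> 'a \<Rightarrow> nat" where
  "degree2 G u = card {v \<in> pverts G. distance G u v = 2}"

definition num_degree2 :: "'a pair_pre_digraph \<Rightarrow> nat \<Rightarrow> nat" where
  "num_degree2 G i = card {u \<in> pverts G. degree2 G u = i}"

definition min_degree2 :: "'a pair_pre_digraph \<Rightarrow> nat" where
  "min_degree2 G = Min (degree2 G ` pverts G)"

definition max_degree2 :: "'a pair_pre_digraph \<Rightarrow> nat" where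
  "max_degree2 G = Max (degree2 G ` pverts G)"

definition first_zagreb :: "'a pair_pre_digraph \<Rightarrow> nat" where
  "first_zagreb G = (\<Sum>u\<in>pverts G. degree G u ^ 2)"

text \<open>
  Since \<open>0 powr \<alpha> = 0\<close> for every \<open>\<alpha>\<close>, this is the intended index for \<open>\<alpha> \<le> 0\<close> only if no vertex
  has 2-distance degree 0.
\<close>

definition leap_zagreb :: "'a pair_pre_digraph \<Rightarrow> real \<Rightarrow> real" where
  "leap_zagreb G \<alpha> = (\<Sum>u\<in>pverts G. real (degree2 G u) powr \<alpha>)"

definition dist2_pairs :: "'a pair_pre_digraph \<Rightarrow> 'a set set" where
  "dist2_pairs G = {{u, v} | u v. u \<in> pverts G \<and> v \<in> pverts G \<and> distance G u v = 2}"

text \<open>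
  Unordered pairs of distinct vertices are two-element vertex sets \<open>e\<close>; for \<open>e = {u, v}\<close> the inner
  sum is \<open>degree2 G u + degree2 G v\<close>. The pairs include the adjacent ones and those at
  distance \<open>\<infinity>\<close>.
\<close>

definition leap_zagreb_coindex :: "'a pair_pre_digraph \<Rightarrow> nat" where
  "leap_zagreb_coindex G =
     (\<Sum>e\<in>{e. e \<subseteq> pverts G \<and> card e = 2 \<and> e \<notin> dist2_pairs G}. \<Sum>u\<in>e. degree2 G u)"

end

theory Submission
  imports Defs
begin

text \<open>
  In a graph without triangles and 4-cycles, the walks \<open>u, w, v\<close> with \<open>v \<noteq> u\<close> correspond one-to-one
  to the pairs at distance 2; counting them by their middle vertex \<open>w\<close> gives
  \<open>\<Sum>\<^sub>u d\<^sub>2(u) = \<Sum>\<^sub>w d(w) (d(w) - 1) = M\<^sub>1 - 2m\<close>. For any \<open>g\<close> and any slope \<open>s\<close>, expanding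
  \<open>g(d\<^sub>2(u))\<close> around the line \<open>g(d) + s (d\<^sub>2(u) - d)\<close> and grouping the vertices by the value of \<open>d\<^sub>2\<close>
  expresses \<open>\<Sum>\<^sub>u g(d\<^sub>2(u))\<close> through \<open>\<Sum>\<^sub>u d\<^sub>2(u)\<close> and the numbers \<open>n\<^sub>i\<close>. The two slopes used are those
  of the chords of \<open>g\<close> over \<open>[d, D]\<close> and over \<open>[d, d + 1]\<close>, which kill two of the remainder terms. The
  general first leap Zagreb index is the case \<open>g(x) = x\<^sup>\<alpha>\<close>. Counting over all pairs and subtracting
  the pairs at distance 2, the coindex is \<open>(n - 1) \<Sum>\<^sub>u d\<^sub>2(u) - \<Sum>\<^sub>u d\<^sub>2(u)\<^sup>2\<close>, so it is covered by
  \<open>g(x) = x\<^sup>2\<close>.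
\<close>

section \<open>Double counting of unordered pairs\<close>

text \<open>Each unordered pair \<open>{a, b}\<close> has exactly two orientations in
  \<open>R\<close>, whose first components contribute \<open>f a + f b\<close>; grouping the ordered
  pairs by first component instead gives the right-hand side. It serves edges, pairs at distance 2,
  and all pairs of distinct vertices.\<close>

lemma sum_unordered_pairs:
  fixes f :: "'a \<Rightarrow> nat"
  assumes "finite V" and "R \<subseteq> V \<times> V" and "sym R" and "irrefl R"
  shows "(\<Sum>e\<in>{{u, v} | u v. (u, v) \<in> R}. \<Sum>x\<in>e. f x) = (\<Sum>u\<in>V. card (R `` {u}) * f u)"
proof -
  have finR: "finite R"
    using assms(1,2) by (meson finite_SigmaI finite_subset)
  define E where "E = (\<lambda>(u, v). {u, v}) ` R"
  have E: "{{u, v} | u v. (u, v) \<in> R} = E"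
    by (auto simp: E_def)
  have fibre: "(\<Sum>(u, v) | (u, v) \<in> R \<and> {u, v} = e. f u) = (\<Sum>x\<in>e. f x)" if "e \<in> E" for e
  proof -
    obtain a b where ab: "(a, b) \<in> R" "e = {a, b}"
      using \<open>e \<in> E\<close> by (auto simp: E_def)
    moreover have "(b, a) \<in> R" "a \<noteq> b"
      using ab assms(3,4) by (auto simp: irrefl_def dest: symD)
    ultimately have "{(u, v). (u, v) \<in> R \<and> {u, v} = e} = {(a, b), (b, a)}"
      by (auto simp: doubleton_eq_iff)
    then show ?thesis
      using ab \<open>a \<noteq> b\<close> by simp
  qed
  have "(\<Sum>u\<in>V. card (R `` {u}) * f u) = (\<Sum>u\<in>V. \<Sum>v\<in>R `` {u}. f u)"
    by simp
  also have "\<dots> = (\<Sum>(u, v)\<in>(SIGMA u:V. R `` {u}). f u)"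
    by (rule sum.Sigma) (use assms(1) finR in auto)
  also have "(SIGMA u:V. R `` {u}) = R"
    using assms(2) by auto
  also have "(\<Sum>(u, v)\<in>R. f u)
      = (\<Sum>e\<in>E. \<Sum>x | x \<in> R \<and> (\<lambda>(u, v). {u, v}) x = e. (\<lambda>(u, v). f u) x)"
    unfolding E_def by (rule sum.image_gen[OF finR])
  also have "\<dots> = (\<Sum>e\<in>E. \<Sum>x\<in>e. f x)"
  proof (rule sum.cong[OF refl])
    fix e assume "e \<in> E"
    have "{x. x \<in> R \<and> (\<lambda>(u, v). {u, v}) x = e} = {(u, v). (u, v) \<in> R \<and> {u, v} = e}"
      by auto
    then show "(\<Sum>x | x \<in> R \<and> (\<lambda>(u, v). {u, v}) x = e. (\<lambda>(u, v). f u) x) = (\<Sum>x\<in>e. f x)"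
      using fibre[OF \<open>e \<in> E\<close>] by simp
  qed
  finally show ?thesis
    unfolding E by simp
qed

section \<open>Distance 2 in terms of arcs\<close>

context pair_graph
begin

text \<open>With unit weights the distance is the infimum of the lengths of walks, so it is 2
  exactly when there is a walk of length 2 and none of length 0 or 1.\<close>

lemma distance_eq_2_iff:
  "distance G u v = 2 \<longleftrightarrow>
     u \<noteq> v \<and> (u, v) \<notin> parcs G \<and> (\<exists>w. (u, w) \<in> parcs G \<and> (w, v) \<in> parcs G)"
proof -
  have cost: "awalk_cost (\<lambda>_. 1) p = real (length p)" for p :: "('a \<times> 'a) list"
    by (induction p) auto
  have le: "distance G u v \<le> ereal (real (length p))" if "awalk u p v" for p
    using min_cost_le_walk_cost[OF that, of "\<lambda>_. 1"] by (simp add: distance_def cost)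
  have ge: "ereal c \<le> distance G u v" if "\<And>p. awalk u p v \<Longrightarrow> c \<le> real (length p)" for c
    unfolding distance_def \<mu>_def by (rule INF_greatest) (simp add: cost that)
  have two: "(2 :: ereal) = ereal 2"
    by simp
  have walk2: "(\<exists>p. awalk u p v \<and> length p = 2)
      \<longleftrightarrow> (\<exists>w. (u, w) \<in> parcs G \<and> (w, v) \<in> parcs G)"
  proof
    assume "\<exists>w. (u, w) \<in> parcs G \<and> (w, v) \<in> parcs G"
    then obtain w where "(u, w) \<in> parcs G" "(w, v) \<in> parcs G" by blast
    then have "awalk u [(u, w), (w, v)] v"
      by (auto simp: awalk_def dest: in_arcsD1)
    then show "\<exists>p. awalk u p v \<and> length p = 2"
      by (intro exI[of _ "[(u, w), (w, v)]"]) simp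
  qed (auto simp: awalk_def length_Suc_conv numeral_2_eq_2)
  have walk1: "(\<exists>p. awalk u p v \<and> length p = 1) \<longleftrightarrow> (u, v) \<in> parcs G"
  proof
    assume "(u, v) \<in> parcs G"
    then show "\<exists>p. awalk u p v \<and> length p = 1"
      by (intro exI[of _ "[(u, v)]"]) (auto simp: awalk_def dest: in_arcsD1)
  qed (auto simp: awalk_def length_Suc_conv)
  have walk0: "(\<exists>p. awalk u p v \<and> length p = 0) \<longleftrightarrow> u = v \<and> u \<in> pverts G"
    by (auto simp: awalk_def)
  show ?thesis
  proof
    assume dist: "distance G u v = 2"
    have ge2: "2 \<le> length p" if "awalk u p v" for p
      using le[OF that] unfolding dist two by simp
    have "\<exists>p. awalk u p v \<and> length p = 2"
    \<comment> \<open>Lengths are integers: without a walk of length 2, all of them would be at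
      least 3, and so would the infimum.\<close>
    proof (rule ccontr)
      assume "\<not> ?thesis"
      then have "3 \<le> length p" if "awalk u p v" for p
        using ge2[OF that] that by (cases "length p = 2") auto
      then have "ereal 3 \<le> distance G u v"
        by (intro ge) force
      then show False
        unfolding dist two by simp
    qed
    moreover have "\<not> (\<exists>p. awalk u p v \<and> length p = 1)" "\<not> (\<exists>p. awalk u p v \<and> length p = 0)"
      using ge2 by force+
    \<comment> \<open>Excluding the empty walk gives \<open>u \<noteq> v\<close> only for a vertex
      \<open>u\<close>; the arc \<open>(u, w)\<close> makes \<open>u\<close> one.\<close>
    ultimately show "u \<noteq> v \<and> (u, v) \<notin> parcs G \<and> (\<exists>w. (u, w) \<in> parcs G \<and> (w, v) \<in> parcs G)"
      using in_arcsD1 unfolding walk0 walk1 walk2 by blast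
  next
    assume R: "u \<noteq> v \<and> (u, v) \<notin> parcs G \<and> (\<exists>w. (u, w) \<in> parcs G \<and> (w, v) \<in> parcs G)"
    then obtain p where p: "awalk u p v" "length p = 2"
      using walk2 by auto
    have "2 \<le> length q" if "awalk u q v" for q
    proof -
      have "length q \<noteq> 0" "length q \<noteq> 1"
        using R that walk0 walk1 by blast+
      then show ?thesis by linarith
    qed
    then have "ereal 2 \<le> distance G u v"
      by (intro ge) force
    then show "distance G u v = 2"
      using le[OF p(1)] p(2) by (simp add: antisym)
  qed
qed

section \<open>Degrees and 2-distance degrees without short cycles\<close>

lemma degree_eq_card: "degree G u = card (parcs G `` {u})"
proof -
  have "out_arcs (with_proj G) u = Pair u ` (parcs G `` {u})"
    by (auto simp: out_arcs_def)
  then show ?thesis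
    by (simp add: degree_def out_degree_def card_image inj_on_def)
qed

lemma finite_neighbours: "finite (parcs G `` {u})"
  using pair_finite_arcs by (rule finite_Image)

lemma sym_parcs: "sym (parcs G)"
  using arcs_symmetric by (auto intro: symI)

lemma sum_degree: "(\<Sum>u\<in>pverts G. degree G u) = 2 * card (edges G)"
proof -
  have "(\<Sum>u\<in>pverts G. degree G u) = (\<Sum>e\<in>edges G. \<Sum>x\<in>e. 1)"
    unfolding edges_def degree_eq_card
    by (subst sum_unordered_pairs[of "pverts G"])
      (use pair_finite_verts in_arcsD1 in_arcsD2 sym_parcs in \<open>auto simp: irrefl_def dest: no_loops'\<close>)
  also have "\<dots> = (\<Sum>e\<in>edges G. 2)"
    by (rule sum.cong) (auto simp: edges_def dest!: no_loops')
  finally show ?thesis by simp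
qed

lemma no_triangle:
  assumes "\<not> has_cycle_of_length G 3" and "(u, v) \<in> parcs G" and "(v, w) \<in> parcs G"
  shows "(u, w) \<notin> parcs G"
proof
  assume "(u, w) \<in> parcs G"
  then have "(w, u) \<in> parcs G"
    by (rule arcs_symmetric)
  then have "cycle [(u, v), (v, w), (w, u)]"
    using assms(2,3) in_arcsD1 no_loops' by (fastforce simp: cycle_def awalk_def)
  then show False
    using assms(1) unfolding has_cycle_of_length_def by fastforce
qed

text \<open>Otherwise \<open>u, w, v, w'\<close> is a 4-cycle: opposite vertices differ by
  assumption, consecutive ones because there are no loops.\<close>

lemma no_square:
  assumes "\<not> has_cycle_of_length G 4" and "u \<noteq> v"
    and "(u, w) \<in> parcs G" and "(w, v) \<in> parcs G"
    and "(u, w') \<in> parcs G" and "(w', v) \<in> parcs G"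
  shows "w = w'"
proof (rule ccontr)
  assume "w \<noteq> w'"
  moreover have "(v, w') \<in> parcs G" "(w', u) \<in> parcs G"
    using assms(5,6) by (auto intro: arcs_symmetric)
  ultimately have "cycle [(u, w), (w, v), (v, w'), (w', u)]"
    using assms(2-4) in_arcsD1 no_loops' by (fastforce simp: cycle_def awalk_def)
  then show False
    using assms(1) unfolding has_cycle_of_length_def by fastforce
qed

text \<open>Without triangles every walk \<open>u, w, v\<close> with \<open>v \<noteq> u\<close>
  ends at distance 2 from \<open>u\<close>; without 4-cycles \<open>v\<close> determines
  \<open>w\<close>. So \<open>snd\<close> maps \<open>P\<close> bijectively onto the vertices at
  distance 2.\<close>

lemma degree2_eq_sum:
  assumes "\<not> has_cycle_of_length G 3" and "\<not> has_cycle_of_length G 4"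
  shows "degree2 G u = (\<Sum>w\<in>parcs G `` {u}. degree G w - 1)"
proof -
  define P where "P = (SIGMA w:parcs G `` {u}. parcs G `` {w} - {u})"
  have "{v \<in> pverts G. distance G u v = 2} = snd ` P"
    unfolding distance_eq_2_iff P_def
    using no_triangle[OF assms(1)] in_arcsD2 by (auto simp: image_iff)
  moreover have "inj_on snd P"
  proof (rule inj_onI)
    fix x y assume "x \<in> P" "y \<in> P" "snd x = snd y"
    then show "x = y"
      using no_square[OF assms(2), of u "snd x" "fst x" "fst y"]
      by (auto simp: P_def prod_eq_iff)
  qed
  ultimately have "degree2 G u = card P"
    by (simp add: degree2_def card_image)
  also have "\<dots> = (\<Sum>w\<in>parcs G `` {u}. card (parcs G `` {w} - {u}))"
    unfolding P_def by (rule card_SigmaI) (auto simp: finite_neighbours)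
  \<comment> \<open>The 1 accounts for \<open>u\<close>, itself a neighbour of \<open>w\<close> by
    symmetry.\<close>
  also have "\<dots> = (\<Sum>w\<in>parcs G `` {u}. degree G w - 1)"
    by (rule sum.cong) (auto simp: degree_eq_card arcs_symmetric)
  finally show ?thesis .
qed

lemma sum_degree2:
  assumes "\<not> has_cycle_of_length G 3" and "\<not> has_cycle_of_length G 4"
  shows "(\<Sum>u\<in>pverts G. degree2 G u) + 2 * card (edges G) = first_zagreb G"
proof -
  have nb: "parcs G `` {u} = {w \<in> pverts G. (u, w) \<in> parcs G}" for u
    using in_arcsD2 by auto
  have nb': "{u \<in> pverts G. (u, w) \<in> parcs G} = parcs G `` {w}" for w
    using in_arcsD1 arcs_symmetric by auto
  have "(\<Sum>u\<in>pverts G. degree2 G u)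
      = (\<Sum>u\<in>pverts G. \<Sum>w | w \<in> pverts G \<and> (u, w) \<in> parcs G. degree G w - 1)"
    unfolding degree2_eq_sum[OF assms] nb by simp
  \<comment> \<open>The summand depends on \<open>w\<close> only, so after the swap it is repeated
    once per neighbour of \<open>w\<close>.\<close>
  also have "\<dots> = (\<Sum>w\<in>pverts G. \<Sum>u | u \<in> pverts G \<and> (u, w) \<in> parcs G. degree G w - 1)"
    by (rule sum.swap_restrict) (rule pair_finite_verts)+
  also have "\<dots> = (\<Sum>w\<in>pverts G. degree G w * (degree G w - 1))"
    unfolding nb' by (simp add: degree_eq_card)
  finally have "(\<Sum>u\<in>pverts G. degree2 G u) + 2 * card (edges G)
      = (\<Sum>w\<in>pverts G. degree G w * (degree G w - 1) + degree G w)"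
    by (simp add: sum_degree sum.distrib)
  also have "\<dots> = first_zagreb G"
    unfolding first_zagreb_def
    by (rule sum.cong) (auto simp: power2_eq_square diff_mult_distrib2)
  finally show ?thesis .
qed

section \<open>The coindex through sums of \<open>degree2\<close> and its square\<close>

text \<open>Double counting is applied to \<open>R\<close>, where \<open>u\<close> has
  \<open>degree2 G u\<close> partners and its weight gets squared, and to \<open>K\<close>, where
  \<open>u\<close> has all other vertices as partners.\<close>

lemma leap_zagreb_coindex_add:
  "leap_zagreb_coindex G + (\<Sum>u\<in>pverts G. (degree2 G u)\<^sup>2)
     = (card (pverts G) - 1) * (\<Sum>u\<in>pverts G. degree2 G u)"
proof -
  define V where "V = pverts G"
  define R where "R = {(u, v). u \<in> V \<and> v \<in> V \<and> distance G u v = 2}"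
  define K where "K = V \<times> V - Id"
  have finV: "finite V"
    unfolding V_def by (rule pair_finite_verts)
  have finP: "finite {e. e \<subseteq> V \<and> card e = 2}"
    using finV by simp
  have symR: "sym R"
    unfolding R_def distance_eq_2_iff by (rule symI) (auto intro: arcs_symmetric)
  have R: "u \<in> V \<and> v \<in> V \<and> u \<noteq> v" if "(u, v) \<in> R" for u v
    using that unfolding R_def distance_eq_2_iff by auto
  have d2: "dist2_pairs G = {{u, v} | u v. (u, v) \<in> R}"
    by (auto simp: dist2_pairs_def R_def V_def)
  have pairs: "{e. e \<subseteq> V \<and> card e = 2} = {{u, v} | u v. (u, v) \<in> K}"
    by (fastforce simp: card_2_iff K_def)
  have sub: "dist2_pairs G \<subseteq> {e. e \<subseteq> V \<and> card e = 2}"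
    unfolding d2 pairs by (auto simp: K_def dest: R)
  have "(\<Sum>e\<in>dist2_pairs G. \<Sum>x\<in>e. degree2 G x) = (\<Sum>u\<in>V. card (R `` {u}) * degree2 G u)"
    unfolding d2
    by (rule sum_unordered_pairs[OF finV _ symR])
      (auto simp: irrefl_def dest: R)
  also have "\<dots> = (\<Sum>u\<in>V. (degree2 G u)\<^sup>2)"
    by (rule sum.cong) (auto simp: R_def V_def degree2_def power2_eq_square Image_def)
  finally have sq: "(\<Sum>e\<in>dist2_pairs G. \<Sum>x\<in>e. degree2 G x) = (\<Sum>u\<in>V. (degree2 G u)\<^sup>2)" .
  have "(\<Sum>e | e \<subseteq> V \<and> card e = 2. \<Sum>x\<in>e. degree2 G x)
      = (\<Sum>u\<in>V. card (K `` {u}) * degree2 G u)"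
    unfolding pairs
    by (rule sum_unordered_pairs[OF finV]) (auto simp: K_def irrefl_def intro: symI)
  also have "\<dots> = (\<Sum>u\<in>V. (card V - 1) * degree2 G u)"
  proof (rule sum.cong[OF refl])
    fix u assume "u \<in> V"
    moreover from this have "K `` {u} = V - {u}"
      by (auto simp: K_def)
    ultimately show "card (K `` {u}) * degree2 G u = (card V - 1) * degree2 G u"
      by simp
  qed
  finally have all: "(\<Sum>e | e \<subseteq> V \<and> card e = 2. \<Sum>x\<in>e. degree2 G x)
      = (card V - 1) * (\<Sum>u\<in>V. degree2 G u)"
    by (simp add: sum_distrib_left)
  have "{e. e \<subseteq> V \<and> card e = 2 \<and> e \<notin> dist2_pairs G}
      = {e. e \<subseteq> V \<and> card e = 2} - dist2_pairs G"
    by auto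
  then have "leap_zagreb_coindex G + (\<Sum>e\<in>dist2_pairs G. \<Sum>x\<in>e. degree2 G x)
      = (\<Sum>e | e \<subseteq> V \<and> card e = 2. \<Sum>x\<in>e. degree2 G x)"
    unfolding leap_zagreb_coindex_def V_def[symmetric]
    using sum.subset_diff[OF sub finP, of "\<lambda>e. \<Sum>x\<in>e. degree2 G x"] by simp
  then show ?thesis
    using all unfolding sq V_def by simp
qed

section \<open>Grouping by 2-distance degree and linear expansion\<close>

lemma sum_by_degree2:
  fixes h :: "nat \<Rightarrow> real"
  shows "(\<Sum>u\<in>pverts G. h (degree2 G u)) =
    (\<Sum>i\<le>max_degree2 G - min_degree2 G.
       real (num_degree2 G (min_degree2 G + i)) * h (min_degree2 G + i))"
proof -
  let ?d = "min_degree2 G" and ?D = "max_degree2 G"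
  have bounds: "?d \<le> degree2 G u" "degree2 G u \<le> ?D" if "u \<in> pverts G" for u
    using that pair_finite_verts by (auto simp: min_degree2_def max_degree2_def)
  have "(\<Sum>u\<in>pverts G. h (degree2 G u)) =
      (\<Sum>i\<le>?D - ?d. \<Sum>u | u \<in> pverts G \<and> degree2 G u - ?d = i. h (degree2 G u))"
    \<comment> \<open>Truncated subtraction is harmless: \<open>bounds\<close> puts every
      \<open>degree2 G u\<close> at or above the minimum.\<close>
    by (rule sum.group[symmetric]) (auto simp: pair_finite_verts dest: bounds intro: diff_le_mono)
  also have "\<dots> = (\<Sum>i\<le>?D - ?d. \<Sum>u | u \<in> pverts G \<and> degree2 G u = ?d + i. h (?d + i))"
    by (intro sum.cong) (auto dest: bounds)
  finally show ?thesis
    by (simp add: num_degree2_def)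
qed

text \<open>Here \<open>h\<close> is the deviation of \<open>g\<close> from the line of slope
  \<open>s\<close> through \<open>(d, g d)\<close>. The line sums to a term in
  \<open>\<Sum>u. degree2 G u\<close>, and \<open>I\<close> needs to contain only the offsets where
  the deviation is nonzero.\<close>

lemma sum_degree2_expansion:
  fixes g :: "nat \<Rightarrow> real" and s :: real
  defines "d \<equiv> min_degree2 G"
  assumes "I \<subseteq> {..max_degree2 G - d}"
    and zero: "\<And>i. i \<le> max_degree2 G - d \<Longrightarrow> i \<notin> I \<Longrightarrow> g (d + i) - g d - real i * s = 0"
  shows "(\<Sum>u\<in>pverts G. g (degree2 G u)) =
    real (card (pverts G)) * g d
    + (real (\<Sum>u\<in>pverts G. degree2 G u) - real (card (pverts G)) * real d) * s
    + (\<Sum>i\<in>I. real (num_degree2 G (d + i)) * (g (d + i) - g d - real i * s))"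
proof -
  define h where "h x = g x - g d - (real x - real d) * s" for x
  have "(\<Sum>u\<in>pverts G. h (degree2 G u)) =
      (\<Sum>i\<le>max_degree2 G - d. real (num_degree2 G (d + i)) * h (d + i))"
    unfolding d_def by (rule sum_by_degree2)
  also have "\<dots> = (\<Sum>i\<in>I. real (num_degree2 G (d + i)) * h (d + i))"
    by (rule sum.mono_neutral_right) (use assms(2) zero in \<open>auto simp: h_def\<close>)
  finally have "(\<Sum>u\<in>pverts G. h (degree2 G u)) =
      (\<Sum>i\<in>I. real (num_degree2 G (d + i)) * (g (d + i) - g d - real i * s))"
    by (simp add: h_def)
  moreover have "(\<Sum>u\<in>pverts G. h (degree2 G u)) =
      (\<Sum>u\<in>pverts G. g (degree2 G u)) - real (card (pverts G)) * g d
      - (real (\<Sum>u\<in>pverts G. degree2 G u) - real (card (pverts G)) * real d) * s"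
    by (simp add: h_def sum_subtractf left_diff_distrib sum_distrib_right)
  ultimately show ?thesis by simp
qed

end

section \<open>The four formulas from two choices of slope\<close>

theorem theorem4p1:
  fixes G :: "'a pair_pre_digraph"
    and n m d D M1 :: nat
    and N :: "nat \<Rightarrow> nat"
    and \<alpha> S :: real
  assumes "pair_graph G"
    and "\<not> has_cycle_of_length G 3"
    and "\<not> has_cycle_of_length G 4"
    and "n = card (pverts G)" and "n \<ge> 3"
    and "m = card (edges G)"
    and "\<And>i. N i = num_degree2 G i"
    and "d = min_degree2 G" and "D = max_degree2 G"
    and "d \<noteq> 0" and "D \<noteq> d" and "D \<ge> 2"
    and "\<alpha> \<notin> {0, 1}"
    and "S = (real D powr \<alpha> - real d powr \<alpha>) / (real D - real d)"
    and "M1 = first_zagreb G"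
  shows
    "leap_zagreb G \<alpha> =
       real n * real d powr \<alpha> + (real M1 - 2 * real m - real n * real d) * S
       + (\<Sum>i = 1..D - d - 1. real (N (d + i)) *
            (real (d + i) powr \<alpha> - real d powr \<alpha> - real i * S))
     \<and> leap_zagreb G \<alpha> =
       real n * real d powr \<alpha>
       + (real M1 - 2 * real m - real n * real d) * (real (d + 1) powr \<alpha> - real d powr \<alpha>)
       + (\<Sum>i = 2..D - d. real (N (d + i)) *
            (real (d + i) powr \<alpha> - real d powr \<alpha>
             - real i * (real (d + 1) powr \<alpha> - real d powr \<alpha>)))
     \<and> real (leap_zagreb_coindex G) =
       (real M1 - 2 * real m) * (real n - 1 - real D - real d) + real n * real d * real D
       - (\<Sum>i = 1..D - d - 1. real (N (d + i)) * real i * (real d + real i - real D))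
     \<and> real (leap_zagreb_coindex G) =
       (real M1 - 2 * real m) * (real n - 2 * real d - 2) + real n * real d * (real d + 1)
       - (\<Sum>i = 2..D - d. real (N (d + i)) * real i * (real i - 1))"
proof -
  interpret pair_graph G by (rule assms(1))
  define A where "A = real M1 - 2 * real m"
  have A: "real (\<Sum>u\<in>pverts G. degree2 G u) = A"
    using sum_degree2[OF assms(2,3)] unfolding A_def assms(6,15) by linarith
  have "pverts G \<noteq> {}"
    using assms(4,5) by auto
  then have "d \<le> D"
    using pair_finite_verts unfolding assms(8,9) min_degree2_def max_degree2_def
    by (meson Max_ge Min_le Min_in finite_imageI image_is_empty order_trans)
  then have "d < D"
    using \<open>D \<noteq> d\<close> by simp
  have expand: "(\<Sum>u\<in>pverts G. g (degree2 G u)) =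
      real n * g d + (A - real n * real d) * s
      + (\<Sum>i\<in>I. real (N (d + i)) * (g (d + i) - g d - real i * s))"
    if "I \<subseteq> {..D - d}" "\<And>i. i \<le> D - d \<Longrightarrow> i \<notin> I \<Longrightarrow> g (d + i) - g d - real i * s = 0"
    for I s and g :: "nat \<Rightarrow> real"
    using sum_degree2_expansion[of I g s] that
    unfolding A assms(4,7) assms(8,9)[symmetric] by blast
  \<comment> \<open>A line agreeing with \<open>g\<close> at \<open>d\<close> and \<open>D\<close>
    removes the offsets 0 and \<open>D - d\<close>.\<close>
  have chord: "(\<Sum>u\<in>pverts G. g (degree2 G u)) =
      real n * g d + (A - real n * real d) * s
      + (\<Sum>i = 1..D - d - 1. real (N (d + i)) * (g (d + i) - g d - real i * s))"
    if "g D - g d = (real D - real d) * s" for s and g :: "nat \<Rightarrow> real"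
  proof (rule expand)
    fix i assume "i \<le> D - d" "i \<notin> {1..D - d - 1}"
    then have "i = 0 \<or> i = D - d" by auto
    then show "g (d + i) - g d - real i * s = 0"
      using that \<open>d < D\<close> by (auto simp: of_nat_diff)
  qed auto
  \<comment> \<open>A line agreeing with \<open>g\<close> at \<open>d\<close> and
    \<open>d + 1\<close> removes the offsets 0 and 1.\<close>
  have tangent: "(\<Sum>u\<in>pverts G. g (degree2 G u)) =
      real n * g d + (A - real n * real d) * s
      + (\<Sum>i = 2..D - d. real (N (d + i)) * (g (d + i) - g d - real i * s))"
    if "g (d + 1) - g d = s" for s and g :: "nat \<Rightarrow> real"
  proof (rule expand)
    fix i assume "i \<le> D - d" "i \<notin> {2..D - d}"
    then have "i = 0 \<or> i = 1" by auto
    then show "g (d + i) - g d - real i * s = 0"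
      using that by auto
  qed auto
  have co: "real (leap_zagreb_coindex G)
      = (real n - 1) * A - (\<Sum>u\<in>pverts G. (real (degree2 G u))\<^sup>2)"
  proof -
    have "real (leap_zagreb_coindex G) + (\<Sum>u\<in>pverts G. (real (degree2 G u))\<^sup>2)
        = real (n - 1) * real (\<Sum>u\<in>pverts G. degree2 G u)"
      using arg_cong[OF leap_zagreb_coindex_add, of real] unfolding assms(4) by simp
    then show ?thesis
      unfolding A using assms(5) by (simp add: of_nat_diff)
  qed
  have "leap_zagreb G \<alpha> =
      real n * real d powr \<alpha> + (A - real n * real d) * S
      + (\<Sum>i = 1..D - d - 1. real (N (d + i)) *
          (real (d + i) powr \<alpha> - real d powr \<alpha> - real i * S))"
    unfolding leap_zagreb_def
    by (rule chord[of "\<lambda>x. real x powr \<alpha>" S]) (use assms(14) \<open>d < D\<close> in simp)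
  moreover have "leap_zagreb G \<alpha> =
      real n * real d powr \<alpha>
      + (A - real n * real d) * (real (d + 1) powr \<alpha> - real d powr \<alpha>)
      + (\<Sum>i = 2..D - d. real (N (d + i)) *
          (real (d + i) powr \<alpha> - real d powr \<alpha>
           - real i * (real (d + 1) powr \<alpha> - real d powr \<alpha>)))"
    unfolding leap_zagreb_def by (rule tangent[of "\<lambda>x. real x powr \<alpha>"]) simp
  moreover have "real (leap_zagreb_coindex G) =
      A * (real n - 1 - real D - real d) + real n * real d * real D
      - (\<Sum>i = 1..D - d - 1. real (N (d + i)) * real i * (real d + real i - real D))"
  proof -
    \<comment> \<open>For squares the slope over \<open>[d, D]\<close> is \<open>D + d\<close>, and
      the deviation factors as \<open>i * (d + i - D)\<close>.\<close>
    have "(\<Sum>u\<in>pverts G. (real (degree2 G u))\<^sup>2) =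
        real n * (real d)\<^sup>2 + (A - real n * real d) * (real D + real d)
        + (\<Sum>i = 1..D - d - 1. real (N (d + i)) *
            ((real (d + i))\<^sup>2 - (real d)\<^sup>2 - real i * (real D + real d)))"
      by (rule chord[of "\<lambda>x. (real x)\<^sup>2"]) (simp add: power2_eq_square algebra_simps)
    moreover have "real (N (d + i)) * ((real (d + i))\<^sup>2 - (real d)\<^sup>2 - real i * (real D + real d))
        = real (N (d + i)) * real i * (real d + real i - real D)" for i
      by (simp add: power2_eq_square algebra_simps)
    ultimately show ?thesis
      unfolding co by (simp add: power2_eq_square algebra_simps)
  qed
  moreover have "real (leap_zagreb_coindex G) =
      A * (real n - 2 * real d - 2) + real n * real d * (real d + 1)
      - (\<Sum>i = 2..D - d. real (N (d + i)) * real i * (real i - 1))"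
  proof -
    \<comment> \<open>Over \<open>[d, d + 1]\<close> the slope is \<open>2 * d + 1\<close>, with
      deviation \<open>i * (i - 1)\<close>.\<close>
    have "(\<Sum>u\<in>pverts G. (real (degree2 G u))\<^sup>2) =
        real n * (real d)\<^sup>2 + (A - real n * real d) * (2 * real d + 1)
        + (\<Sum>i = 2..D - d. real (N (d + i)) *
            ((real (d + i))\<^sup>2 - (real d)\<^sup>2 - real i * (2 * real d + 1)))"
      by (rule tangent[of "\<lambda>x. (real x)\<^sup>2"]) (simp add: power2_eq_square algebra_simps)
    moreover have "real (N (d + i)) * ((real (d + i))\<^sup>2 - (real d)\<^sup>2 - real i * (2 * real d + 1))
        = real (N (d + i)) * real i * (real i - 1)" for i
      by (simp add: power2_eq_square algebra_simps)
    ultimately show ?thesis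
      unfolding co by (simp add: power2_eq_square algebra_simps)
  qed
  ultimately show ?thesis
    unfolding A_def by blast
qed

end
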